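(* Consider the generalized Sudoku problem with data $n, \pi_1, \pi_2, \pi_3, i_1, \ldots, i_k, g_{i_1}, \ldots, g_{i_k}$ and solution set $S(n,g)$. Let $J$ be a $p$-$q$-rectangle for some $2 \le p \le n$ and $1 \le q \le n$. Suppose $x$ is the unique solution of the generalized Sudoku problem (i.e., $S(n,g) = \{x\}$) and $x$ is minimal on $J$. Then $J \cap \{i_1, \ldots, i_k\} \ne \emptyset$.
   Context: For $y \in \mathbb{Z}^s$ write $y <> \mathbf{0}$ if every component of $y$ is nonzero. Let $n \ge 2$ and $s(n) = \sum_{i=1}^{n-1} i$. The $s(n) \times n$ matrix $A(n)$ is defined inductively: $A(1)$ is the empty matrix, and $A(m) = \begin{pmatrix} \mathbf{1}_{m-1} & -U_{m-1} \\ \mathbf{0}_{s(m-1)} & A(m-1) \end{pmatrix}$, where $\mathbf{1}_{m-1}$ is the all-ones column, $U_{m-1}$ the identity matrix and $\mathbf{0}_{s(m-1)}$ the zero column of length $s(m-1)$. Let $A$ be the $(n \cdot s(n)) \times n^2$ block-diagonal matrix whose $n$ diagonal blocks all equal $A(n)$. For a permutation $\pi$ of $\{1,\ldots,n^2\}$, $A_\pi$ is the matrix whose $j$-th column is the $\pi^{-1}(j)$-th column of $A$, and the constraint sets of $\pi$ are $cs_\pi(j) = \{\pi(i) \mid (j-1)n + 1 \le i \le jn\}$, $j=1,\ldots,n$. Generalized Sudoku problem: given permutations $\pi_1, \pi_2, \pi_3$ of $\{1, \ldots, n^2\}$, an integer $0 \le k \le n^2$, an index set $\{i_1, \ldots,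 i_k\} \subset \{1, \ldots, n^2\}$ (the givens' cells) and givens $g_{i_l} \in \mathbb{Z}$ with $1 \le g_{i_l} \le n$, its solution set is $S(n,g) = \{x \in \mathbb{Z}^{n^2} \mid 1 \le x_i \le n \ (i = 1,\ldots,n^2),\ A_{\pi_r}x <> \mathbf{0}\ (r = 1,2,3),\ x_{i_l} = g_{i_l}\ (l = 1, \ldots, k)\}$. For $1 \le p, q \le n$, a set $J \subset \{1, \ldots, n^2\}$ with $p \cdot q$ elements is a $p$-$q$-rectangle if for each $r = 1,2,3$ there exist distinct indices $j_{r,1}, \ldots, j_{r,q} \in \{1, \ldots, n\}$ with $\sharp(J \cap cs_{\pi_r}(j_{r,s})) = p$ for $s = 1, \ldots, q$. A point $x \in S(n,g)$ is minimal on a $p$-$q$-rectangle $J$ if $\sharp\{x_i \mid i \in J\} = p$. *)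

theory Defs
  imports "Jordan_Normal_Form.Matrix" "HOL-Combinatorics.Permutations"
begin

text \<open>
  Indices start at 0, as usual for vectors and matrices in \<open>Jordan_Normal_Form.Matrix\<close>:
  cells are \<open>{..<n\<^sup>2}\<close> instead of \<open>{1..n\<^sup>2}\<close> and constraint sets are numbered by
  \<open>{..<n}\<close> instead of \<open>{1..n}\<close>.  Cell values range over \<open>{1..n}\<close>.
\<close>

definition s_rows :: "nat \<Rightarrow> nat" where
  "s_rows n = (\<Sum>i = 1..n - 1. i)"

text \<open>The value at 0 is a dummy.  \<open>A(1)\<close> has no rows but one column.\<close>

fun A_block :: "nat \<Rightarrow> int mat" where
  "A_block 0 = 0\<^sub>m 0 0"
| "A_block (Suc 0) = 0\<^sub>m 0 1"
| "A_block (Suc (Suc m)) =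
     four_block_mat (mat (Suc m) 1 (\<lambda>_. 1)) (- 1\<^sub>m (Suc m))
                    (0\<^sub>m (s_rows (Suc m)) 1)     (A_block (Suc m))"

lemma s_rows_Suc: "s_rows (Suc m) = m + s_rows m"
  by (cases m) (simp_all add: s_rows_def)

lemma dim_A_block: "dim_row (A_block n) = s_rows n" "dim_col (A_block n) = n"
  by (induction n rule: A_block.induct) (simp_all add: s_rows_Suc, simp_all add: s_rows_def)

definition A_mat :: "nat \<Rightarrow> int mat" where
  "A_mat n = diag_block_mat (replicate n (A_block n))"

lemma dim_A_mat: "dim_row (A_mat n) = n * s_rows n" "dim_col (A_mat n) = n\<^sup>2"
  by (simp_all add: A_mat_def dim_diag_block_mat dim_A_block sum_list_replicate power2_eq_square)

definition A_perm :: "nat \<Rightarrow> (nat \<Rightarrow> nat) \<Rightarrow> int mat" where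
  "A_perm n \<pi> = mat (n * s_rows n) (n\<^sup>2) (\<lambda>(i, j). A_mat n $$ (i, inv_into UNIV \<pi> j))"

definition cs :: "nat \<Rightarrow> (nat \<Rightarrow> nat) \<Rightarrow> nat \<Rightarrow> nat set" where
  "cs n \<pi> j = {\<pi> i | i. j * n \<le> i \<and> i < (j + 1) * n}"

text \<open>The relation written \<open>y <> 0\<close>: every component is nonzero, which is stronger than
  \<open>y \<noteq> 0\<close>.\<close>

definition all_nonzero :: "int vec \<Rightarrow> bool" where
  "all_nonzero y \<longleftrightarrow> (\<forall>i < dim_vec y. y $ i \<noteq> 0)"

text \<open>\<open>I\<close> is the set of the cells of the givens (so \<open>k = card I\<close>); \<open>g\<close> is only used on \<open>I\<close>,
  and \<open>\<pi>\<close> only on \<open>{1, 2, 3}\<close>.\<close>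

definition sudoku_data ::
    "nat \<Rightarrow> (nat \<Rightarrow> nat \<Rightarrow> nat) \<Rightarrow> nat set \<Rightarrow> (nat \<Rightarrow> int) \<Rightarrow> bool" where
  "sudoku_data n \<pi> I g \<longleftrightarrow>
     n \<ge> 2 \<and>
     (\<forall>r\<in>{1, 2, 3}. \<pi> r permutes {..<n\<^sup>2}) \<and>
     I \<subseteq> {..<n\<^sup>2} \<and>
     (\<forall>i\<in>I. 1 \<le> g i \<and> g i \<le> int n)"

definition solutions ::
    "nat \<Rightarrow> (nat \<Rightarrow> nat \<Rightarrow> nat) \<Rightarrow> nat set \<Rightarrow> (nat \<Rightarrow> int) \<Rightarrow> int vec set" where
  "solutions n \<pi> I g =
     {x \<in> carrier_vec (n\<^sup>2).
        (\<forall>i < n\<^sup>2. 1 \<le> x $ i \<and> x $ i \<le> int n) \<and>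
        (\<forall>r\<in>{1, 2, 3}. all_nonzero (A_perm n (\<pi> r) *\<^sub>v x)) \<and>
        (\<forall>i\<in>I. x $ i = g i)}"

definition rectangle ::
    "nat \<Rightarrow> (nat \<Rightarrow> nat \<Rightarrow> nat) \<Rightarrow> nat \<Rightarrow> nat \<Rightarrow> nat set \<Rightarrow> bool" where
  "rectangle n \<pi> p q J \<longleftrightarrow>
     1 \<le> p \<and> p \<le> n \<and> 1 \<le> q \<and> q \<le> n \<and>
     J \<subseteq> {..<n\<^sup>2} \<and> card J = p * q \<and>
     (\<forall>r\<in>{1, 2, 3}. \<exists>j :: nat \<Rightarrow> nat.
        inj_on j {1..q} \<and> j ` {1..q} \<subseteq> {..<n} \<and>
        (\<forall>t\<in>{1..q}. card (J \<inter> cs n (\<pi> r) (j t)) = p))"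

definition minimal_on :: "int vec \<Rightarrow> nat \<Rightarrow> nat set \<Rightarrow> bool" where
  "minimal_on x p J \<longleftrightarrow> card {x $ i | i. i \<in> J} = p"

end

theory Submission
  imports Defs
begin

text \<open>
  The condition \<open>A\<^sub>\<pi> x <> 0\<close> says that \<open>x\<close> is injective on every constraint set of \<open>\<pi>\<close>.
  A \<open>p\<close>-\<open>q\<close>-rectangle \<open>J\<close> is exhausted by its \<open>q\<close> constraint sets, so that it meets every
  constraint set in \<open>0\<close> or \<open>p\<close> cells.  If \<open>x\<close> has exactly \<open>p\<close> values on \<open>J\<close>, then
  each constraint set that meets \<open>J\<close> has all of these values on \<open>J\<close> and none of them
  outside \<open>J\<close>.  Hence exchanging two of the values on \<open>J\<close> preserves all the constraints,
  and it yields a second solution if \<open>J\<close> contains no given.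
\<close>

lemma all_nonzero_append: "all_nonzero (v @\<^sub>v w) \<longleftrightarrow> all_nonzero v \<and> all_nonzero w"
proof
  assume vw: "all_nonzero (v @\<^sub>v w)"
  have "v $ i \<noteq> 0" if "i < dim_vec v" for i
    using vw[unfolded all_nonzero_def, rule_format, of i] that by simp
  moreover have "w $ i \<noteq> 0" if "i < dim_vec w" for i
    using vw[unfolded all_nonzero_def, rule_format, of "dim_vec v + i"] that by simp
  ultimately show "all_nonzero v \<and> all_nonzero w"
    by (simp add: all_nonzero_def)
qed (simp add: all_nonzero_def)

lemma vec_add_eq_append:
  "vec (m + k) f = vec m f @\<^sub>v vec k (\<lambda>i. f (m + i))"
  by (rule eq_vecI) auto

text \<open>Splits pairs of indices the way the recursion of \<open>A_block\<close> splits rows: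
  pairs containing 0 belong to the upper blocks, all others to the lower ones.\<close>

lemma inj_on_lessThan_Suc_shift:
  "inj_on f {..<Suc n} \<longleftrightarrow> inj_on (\<lambda>i. f (Suc i)) {..<n} \<and> (\<forall>i<n. f 0 \<noteq> f (Suc i))"
proof -
  have "inj_on f (Suc ` {..<n}) \<longleftrightarrow> inj_on (f \<circ> Suc) {..<n}"
    by (simp add: comp_inj_on_iff)
  then show ?thesis
    by (auto simp: lessThan_Suc_eq_insert_0 o_def)
qed

text \<open>Each pair of columns \<open>i < j\<close> has exactly one row, with 1 at
  \<open>i\<close> and -1 at \<open>j\<close>, so the entries of the product are the differences
  \<open>f i - f j\<close>.\<close>

lemma all_nonzero_A_block:
  "all_nonzero (A_block n *\<^sub>v vec n f) \<longleftrightarrow> inj_on f {..<n}"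
proof (induction n arbitrary: f rule: A_block.induct)
  case 1
  then show ?case by (simp add: all_nonzero_def)
next
  case 2
  then show ?case by (simp add: all_nonzero_def lessThan_Suc)
next
  case (3 m)
  let ?n = "Suc m" and ?a = "vec 1 f" and ?d = "vec (Suc m) (\<lambda>i. f (Suc i))"
  \<comment> \<open>The upper part of the product: the column of ones repeats \<open>f 0\<close>,
    and the negated identity subtracts the remaining entries.\<close>
  let ?B = "mat ?n 1 (\<lambda>_. 1) *\<^sub>v ?a + - 1\<^sub>m ?n *\<^sub>v ?d"
  have v: "vec (Suc ?n) f = ?a @\<^sub>v ?d"
    using vec_add_eq_append[of 1 ?n f] by simp
  have D: "A_block ?n \<in> carrier_mat (s_rows ?n) ?n"
    by (intro carrier_matI dim_A_block)
  have "A_block (Suc ?n) *\<^sub>v vec (Suc ?n) f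
      = ?B @\<^sub>v (0\<^sub>m (s_rows ?n) 1 *\<^sub>v ?a + A_block ?n *\<^sub>v ?d)"
    unfolding v A_block.simps by (rule four_block_mat_mult_vec) (use D in auto)
  also have "0\<^sub>m (s_rows ?n) 1 *\<^sub>v ?a + A_block ?n *\<^sub>v ?d = A_block ?n *\<^sub>v ?d"
    using D by (intro eq_vecI) auto
  finally have *: "A_block (Suc ?n) *\<^sub>v vec (Suc ?n) f = ?B @\<^sub>v A_block ?n *\<^sub>v ?d" .
  have "?B $ i = f 0 - f (Suc i)" if "i < ?n" for i
    using that by (simp add: scalar_prod_def)
  then have "all_nonzero ?B \<longleftrightarrow> (\<forall>i<?n. f 0 \<noteq> f (Suc i))"
    by (simp add: all_nonzero_def)
  then show ?case
    unfolding * all_nonzero_append inj_on_lessThan_Suc_shift[of f ?n] "3.IH" by blast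
qed

lemma all_nonzero_diag_A_block:
  "all_nonzero (diag_block_mat (replicate k (A_block n)) *\<^sub>v vec (k * n) f)
     \<longleftrightarrow> (\<forall>b<k. inj_on (\<lambda>i. f (b * n + i)) {..<n})"
proof (induction k arbitrary: f)
  case 0
  then show ?case by (simp add: all_nonzero_def)
next
  case (Suc k)
  let ?D = "diag_block_mat (replicate k (A_block n))" and ?d = "vec (k * n) (\<lambda>i. f (n + i))"
  have A: "A_block n \<in> carrier_mat (s_rows n) n"
    by (intro carrier_matI dim_A_block)
  have D: "?D \<in> carrier_mat (k * s_rows n) (k * n)"
    by (intro carrier_matI) (simp_all add: dim_diag_block_mat dim_A_block sum_list_replicate)
  have "diag_block_mat (replicate (Suc k) (A_block n)) *\<^sub>v vec (Suc k * n) f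
      = (A_block n *\<^sub>v vec n f + 0\<^sub>m (s_rows n) (k * n) *\<^sub>v ?d)
        @\<^sub>v (0\<^sub>m (k * s_rows n) n *\<^sub>v vec n f + ?D *\<^sub>v ?d)"
    using A D unfolding mult_Suc vec_add_eq_append replicate_Suc diag_block_mat.simps Let_def
    by (subst four_block_mat_mult_vec) auto
  also have "A_block n *\<^sub>v vec n f + 0\<^sub>m (s_rows n) (k * n) *\<^sub>v ?d = A_block n *\<^sub>v vec n f"
    using A by (intro eq_vecI) auto
  also have "0\<^sub>m (k * s_rows n) n *\<^sub>v vec n f + ?D *\<^sub>v ?d = ?D *\<^sub>v ?d"
    using D by (intro eq_vecI) auto
  \<comment> \<open>The first diagonal block accounts for \<open>b = 0\<close>; the induction
    hypothesis for \<open>f\<close> shifted by \<open>n\<close> accounts for the later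
    blocks.\<close>
  finally show ?case
    by (simp add: all_nonzero_append all_nonzero_A_block Suc.IH All_less_Suc2 add.assoc)
qed

text \<open>Reindexing the sum over columns by \<open>\<pi>\<close> moves the inverse permutation
  off the matrix and onto the entries of the vector, which leaves a block-diagonal product.\<close>

lemma A_perm_mult_vec:
  assumes \<pi>: "\<pi> permutes {..<n\<^sup>2}" and x: "x \<in> carrier_vec (n\<^sup>2)"
  shows "A_perm n \<pi> *\<^sub>v x = A_mat n *\<^sub>v vec (n\<^sup>2) (\<lambda>i. x $ \<pi> i)"
proof (rule eq_vecI)
  fix i assume "i < dim_vec (A_mat n *\<^sub>v vec (n\<^sup>2) (\<lambda>i. x $ \<pi> i))"
  then have i: "i < n * s_rows n" by (simp add: dim_A_mat)
  have "(A_perm n \<pi> *\<^sub>v x) $ i = (\<Sum>j<n\<^sup>2. A_mat n $$ (i, inv_into UNIV \<pi> j) * x $ j)"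
    using i x by (simp add: A_perm_def scalar_prod_def atLeast0LessThan)
  also have "\<dots> = (\<Sum>j<n\<^sup>2. A_mat n $$ (i, j) * x $ \<pi> j)"
    by (subst sum.permute[OF \<pi>]) (simp add: o_def permutes_inverses[OF \<pi>])
  also have "\<dots> = (A_mat n *\<^sub>v vec (n\<^sup>2) (\<lambda>i. x $ \<pi> i)) $ i"
    using i by (simp add: scalar_prod_def atLeast0LessThan dim_A_mat)
  finally show "(A_perm n \<pi> *\<^sub>v x) $ i = (A_mat n *\<^sub>v vec (n\<^sup>2) (\<lambda>i. x $ \<pi> i)) $ i" .
qed (simp add: A_perm_def dim_A_mat)

lemma cs_eq_image: "cs n \<pi> j = (\<lambda>i. \<pi> (j * n + i)) ` {..<n}"
proof -
  have "\<pi> i \<in> (\<lambda>i. \<pi> (j * n + i)) ` {..<n}" if "j * n \<le> i" "i < (j + 1) * n" for i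
    by (rule image_eqI[of _ _ "i - j * n"]) (use that in auto)
  then show ?thesis by (fastforce simp: cs_def)
qed

text \<open>Diagonal block \<open>j\<close> sees the entries of \<open>x\<close> at
  \<open>\<pi> (j * n + i)\<close> for \<open>i < n\<close>, which are the cells of
  \<open>cs n \<pi> j\<close>. From here on the matrices are used only through this
  equivalence.\<close>

lemma all_nonzero_A_perm:
  assumes \<pi>: "\<pi> permutes {..<n\<^sup>2}" and x: "x \<in> carrier_vec (n\<^sup>2)"
  shows "all_nonzero (A_perm n \<pi> *\<^sub>v x) \<longleftrightarrow> (\<forall>j<n. inj_on (($) x) (cs n \<pi> j))"
proof -
  have "inj_on (\<lambda>i. \<pi> (j * n + i)) {..<n}" for j
    by (rule inj_onI) (auto dest: injD[OF permutes_inj[OF \<pi>]])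
  from comp_inj_on_iff[OF this]
  have "inj_on (($) x) (cs n \<pi> j) \<longleftrightarrow> inj_on (\<lambda>i. x $ \<pi> (j * n + i)) {..<n}" for j
    by (simp add: cs_eq_image o_def)
  then show ?thesis
    by (simp add: A_perm_mult_vec[OF \<pi> x] A_mat_def power2_eq_square all_nonzero_diag_A_block)
qed

lemma cs_disjoint:
  assumes "inj \<pi>" and "j \<noteq> k"
  shows "cs n \<pi> j \<inter> cs n \<pi> k = {}"
proof -
  \<comment> \<open>The number of a constraint set is recovered from the preimage of any of its
    cells.\<close>
  have "i div n = j" if "j * n \<le> i" "i < (j + 1) * n" for i j
    using that by (intro div_nat_eqI) (auto simp: mult.commute)
  then show ?thesis
    using assms unfolding cs_def by (blast dest: injD)
qed

text \<open>The chosen constraint sets are pairwise disjoint, so their parts in \<open>J\<close>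
  have \<open>p * q = card J\<close> cells together and fill \<open>J\<close>. Any other constraint
  set is disjoint from them and misses \<open>J\<close>.\<close>

lemma rectangle_inter_cs:
  assumes R: "rectangle n \<pi> p q J" and r: "r \<in> {1, 2, 3}" and inj: "inj (\<pi> r)"
  shows "J \<inter> cs n (\<pi> r) k = {} \<or> card (J \<inter> cs n (\<pi> r) k) = p"
proof -
  from R r obtain j where j: "inj_on j {1..q}"
    and c: "\<And>t. t \<in> {1..q} \<Longrightarrow> card (J \<inter> cs n (\<pi> r) (j t)) = p"
    unfolding rectangle_def by meson
  have J: "finite J" "card J = p * q"
    using R finite_subset[of J "{..<n\<^sup>2}"] by (auto simp: rectangle_def)
  let ?U = "\<Union>t\<in>{1..q}. J \<inter> cs n (\<pi> r) (j t)"
  have "card ?U = (\<Sum>t\<in>{1..q}. card (J \<inter> cs n (\<pi> r) (j t)))"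
  proof (rule card_UN_disjoint)
    show "\<forall>t\<in>{1..q}. \<forall>u\<in>{1..q}. t \<noteq> u \<longrightarrow>
        J \<inter> cs n (\<pi> r) (j t) \<inter> (J \<inter> cs n (\<pi> r) (j u)) = {}"
      using cs_disjoint[OF inj] inj_onD[OF j] by blast
  qed (use J in auto)
  also have "\<dots> = card J"
    using c J by simp
  finally have U: "?U = J"
    using J by (intro card_subset_eq) auto
  show ?thesis
  proof (cases "k \<in> j ` {1..q}")
    case True
    then show ?thesis using c by auto
  next
    case False
    then have "?U \<inter> cs n (\<pi> r) k = {}"
      using cs_disjoint[OF inj] by blast
    then show ?thesis using U by simp
  qed
qed

lemma inj_on_transpose_values:
  assumes inj: "inj_on f C" and J: "finite J"
    and C: "J \<inter> C = {} \<or> card (J \<inter> C) = card (f ` J)"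
    and a: "a \<in> f ` J" and b: "b \<in> f ` J"
  shows "inj_on (\<lambda>i. if i \<in> J then transpose a b (f i) else f i) C"
proof (cases "J \<inter> C = {}")
  case True
  then have "i \<notin> J" if "i \<in> C" for i using that by blast
  then show ?thesis using inj by (simp add: inj_on_def)
next
  case False
  have "card (f ` (J \<inter> C)) = card (f ` J)"
    using False C card_image[OF inj_on_subset[OF inj, of "J \<inter> C"]] by simp
  then have V: "f ` (J \<inter> C) = f ` J"
    using J by (intro card_subset_eq) auto
  \<comment> \<open>By \<open>V\<close> a value taken on \<open>J\<close> already occurs in
    \<open>J \<inter> C\<close>, so injectivity on \<open>C\<close> forbids it elsewhere in
    \<open>C\<close>.\<close>
  have outside: "f i \<notin> f ` J" if "i \<in> C - J" for i
    using that inj unfolding V[symmetric] by (auto dest: inj_onD)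
  have inside: "transpose a b (f i) \<in> f ` J" if "i \<in> J" for i
    using that a b by (auto simp: transpose_def)
  show ?thesis
  proof (rule inj_onI)
    fix i k assume i: "i \<in> C" and k: "k \<in> C"
      and eq: "(if i \<in> J then transpose a b (f i) else f i)
             = (if k \<in> J then transpose a b (f k) else f k)"
    \<comment> \<open>The new value reveals whether a cell of \<open>C\<close> lies in
      \<open>J\<close>: it is in the image of \<open>J\<close> exactly for cells of
      \<open>J\<close>.\<close>
    have "i \<in> J \<longleftrightarrow> k \<in> J"
      using eq outside inside i k by (metis DiffI)
    then have "f i = f k"
      using eq by (auto split: if_splits dest: injD[OF inj_transpose])
    then show "i = k" using inj i k by (auto dest: inj_onD)
  qed
qed

theorem theorem6p2:
  fixes n p q :: nat
    and \<pi> :: "nat \<Rightarrow> nat \<Rightarrow> nat"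
    and I J :: "nat set"
    and g :: "nat \<Rightarrow> int"
    and x :: "int vec"
  assumes "sudoku_data n \<pi> I g"
    and "2 \<le> p" and "p \<le> n" and "1 \<le> q" and "q \<le> n"
    and "rectangle n \<pi> p q J"
    and "solutions n \<pi> I g = {x}"
    and "minimal_on x p J"
  shows "J \<inter> I \<noteq> {}"
proof
  assume JI: "J \<inter> I = {}"
  have perm: "\<pi> r permutes {..<n\<^sup>2}" if "r \<in> {1, 2, 3}" for r
    using assms(1) that by (auto simp: sudoku_data_def)
  have I: "I \<subseteq> {..<n\<^sup>2}"
    using assms(1) by (auto simp: sudoku_data_def)
  have J: "J \<subseteq> {..<n\<^sup>2}"
    using assms(6) by (auto simp: rectangle_def)
  then have "finite J" using finite_subset by blast
  have "x \<in> solutions n \<pi> I g" using assms(7) by simp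
  then have x: "x \<in> carrier_vec (n\<^sup>2)"
    and bounds: "\<And>i. i < n\<^sup>2 \<Longrightarrow> 1 \<le> x $ i \<and> x $ i \<le> int n"
    and nonzero: "\<And>r. r \<in> {1, 2, 3} \<Longrightarrow> all_nonzero (A_perm n (\<pi> r) *\<^sub>v x)"
    and givens: "\<And>i. i \<in> I \<Longrightarrow> x $ i = g i"
    by (auto simp: solutions_def)
  have V: "card (($) x ` J) = p"
    using assms(8) by (simp add: minimal_on_def Setcompr_eq_image)
  \<comment> \<open>This is where \<open>2 \<le> p\<close> matters: there must be two distinct
    values to exchange.\<close>
  have "\<not> card (($) x ` J) \<le> Suc 0" using V \<open>2 \<le> p\<close> by simp
  then obtain a b where a: "a \<in> ($) x ` J" and b: "b \<in> ($) x ` J" and "a \<noteq> b"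
    unfolding card_le_Suc0_iff_eq[OF finite_imageI[OF \<open>finite J\<close>]] by blast
  define f where "f i = (if i \<in> J then transpose a b (x $ i) else x $ i)" for i
  have "vec (n\<^sup>2) f \<in> solutions n \<pi> I g"
    unfolding solutions_def mem_Collect_eq
  proof (intro conjI allI ballI impI)
    fix i assume i: "i < n\<^sup>2"
    \<comment> \<open>The exchange only produces values that \<open>x\<close> already takes on
      \<open>J\<close>, so the range is kept.\<close>
    have "1 \<le> v \<and> v \<le> int n" if "v \<in> ($) x ` J" for v
      using that J bounds by auto
    then have "1 \<le> f i \<and> f i \<le> int n"
      using a b bounds[OF i] by (auto simp: f_def transpose_def)
    then show "1 \<le> vec (n\<^sup>2) f $ i" "vec (n\<^sup>2) f $ i \<le> int n" using i by auto
  next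
    fix r :: nat assume r: "r \<in> {1, 2, 3}"
    have "inj_on (($) (vec (n\<^sup>2) f)) (cs n (\<pi> r) j)" if j: "j < n" for j
    proof -
      have "inj_on (($) x) (cs n (\<pi> r) j)"
        using nonzero[OF r] all_nonzero_A_perm[OF perm[OF r] x] j by blast
      \<comment> \<open>Minimality enters through \<open>V\<close>: the number of values on
        \<open>J\<close> equals the size \<open>p\<close> of each nonempty intersection with a
        constraint set.\<close>
      from inj_on_transpose_values[OF this \<open>finite J\<close> _ a b]
      have inj: "inj_on f (cs n (\<pi> r) j)"
        using rectangle_inter_cs[OF assms(6) r permutes_inj[OF perm[OF r]]] V
        unfolding f_def by simp
      \<comment> \<open>All cells of the constraint set are thus valid indices, where the entries of
        the vector agree with \<open>f\<close>.\<close>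
      have "(j + 1) * n \<le> n\<^sup>2"
        using j unfolding power2_eq_square by (intro mult_le_mono1) simp
      then have "cs n (\<pi> r) j \<subseteq> {..<n\<^sup>2}"
        using permutes_in_image[OF perm[OF r]] by (fastforce simp: cs_def)
      then have "vec (n\<^sup>2) f $ i = f i" if "i \<in> cs n (\<pi> r) j" for i
        using that by auto
      then show ?thesis using inj by (simp add: inj_on_def)
    qed
    then show "all_nonzero (A_perm n (\<pi> r) *\<^sub>v vec (n\<^sup>2) f)"
      using all_nonzero_A_perm[OF perm[OF r]] by simp
  next
    fix i assume "i \<in> I"
    then have "i < n\<^sup>2" "i \<notin> J" using I JI by auto
    then show "vec (n\<^sup>2) f $ i = g i"
      using givens[OF \<open>i \<in> I\<close>] by (simp add: f_def)
  qed simp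
  then have eq: "vec (n\<^sup>2) f = x" using assms(7) by simp
  \<comment> \<open>A cell of \<open>J\<close> with value \<open>a\<close> gets value
    \<open>b\<close>, so the new solution differs from \<open>x\<close>.\<close>
  obtain i where i: "i \<in> J" "a = x $ i" using a by auto
  then have "vec (n\<^sup>2) f $ i = b" using J by (auto simp: f_def)
  then show False using eq i \<open>a \<noteq> b\<close> by simp
qed

end
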